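(* Reweighted Approval Voting ($\mathit{RAV}$) satisfies JR for $k=2$, but fails it for $k\ge 10$. That is: (1) for every ballot profile $\vec{A}$ over a candidate set $C$ with $|C|\ge 2$, every committee that can be output by $\mathit{RAV}$ on $(\vec{A},2)$ (irrespective of tie-breaking) provides justified representation for $(\vec{A},2)$; (2) for every $k\ge 10$ there exist a candidate set $C$ and a ballot profile $\vec{A}$ over $C$ such that the committee output by $\mathit{RAV}$ on $(\vec{A},k)$ (whatever the tie-breaking rule) does not provide justified representation for $(\vec{A},k)$.
   Context: Setting. $N=\{1,\dots,n\}$ ($n\ge 1$) is a set of voters, $C$ is a finite set of candidates. Each voter $i\in N$ submits an approval ballot $A_i\subseteq C$; the list $\vec{A}=(A_1,\dots,A_n)$ is the ballot profile. An approval-based multi-winner rule takes $(N,C,\vec{A},k)$ with $1\le k\le|C|$ and returns a committee $W\subseteq C$ with $|W|=k$. Justified representation (JR). A set $W\subseteq C$ with $|W|=k$ provides justified representation for $(\vec{A},k)$ if there is no set of voters $N^*\subseteq N$ with $|N^*|\ge \frac{n}{k}$ such that $\bigcap_{i\in N^*}A_i\neq\emptyset$ and $A_i\cap W=\emptyset$ for all $i\in N^*$. $\mathit{RAV}$ starts with $W=\emptyset$. In each round $j=1,\dots,k$ it computes the approval weight of each candidate $c\in C\setminus W$ as $\sum_{i:\,c\in A_i}\frac{1}{1+|W\cap A_i|}$, selects a (not yet selected) candidate with the highest approval weight, and adds it to $W$. After $k$ rounds it outputs $W$. *)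

theory Defs
  imports Complex_Main
begin

text \<open>
  Voters are \<^term>\<open>{1..n}\<close>; the profile \<^term>\<open>A :: nat \<Rightarrow> 'c set\<close> is only ever consulted on voters.
\<close>

definition election :: "nat \<Rightarrow> 'c set \<Rightarrow> (nat \<Rightarrow> 'c set) \<Rightarrow> nat \<Rightarrow> bool" where
  "election n C A k \<longleftrightarrow>
     1 \<le> n \<and> finite C \<and> (\<forall>i\<in>{1..n}. A i \<subseteq> C) \<and> 1 \<le> k \<and> k \<le> card C"

text \<open>
  Only meaningful for committees \<open>W \<subseteq> C\<close> with \<open>card W = k\<close>; this side condition is kept
  out of the definition so that its negation does not hold for trivial reasons.
  The empty group, whose intersection is \<^term>\<open>UNIV\<close>, is excluded by the size bound,
  since \<open>n / k > 0\<close> in every election.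
\<close>

definition provides_JR :: "nat \<Rightarrow> (nat \<Rightarrow> 'c set) \<Rightarrow> nat \<Rightarrow> 'c set \<Rightarrow> bool" where
  "provides_JR n A k W \<longleftrightarrow>
     \<not> (\<exists>N'\<subseteq>{1..n}. real (card N') \<ge> real n / real k \<and>
          (\<Inter>i\<in>N'. A i) \<noteq> {} \<and> (\<forall>i\<in>N'. A i \<inter> W = {}))"

definition approval_weight :: "nat \<Rightarrow> (nat \<Rightarrow> 'c set) \<Rightarrow> 'c set \<Rightarrow> 'c \<Rightarrow> real" where
  "approval_weight n A W c =
     (\<Sum>i | i \<in> {1..n} \<and> c \<in> A i. 1 / (1 + real (card (W \<inter> A i))))"

text \<open>
  \<open>RAV n C A j W\<close>: for some resolution of the ties, \<open>W\<close> is the set selected after \<open>j\<close> rounds.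
  Hence \<open>RAV n C A k W\<close> says that \<open>W\<close> is a possible output for committee size \<open>k\<close>.
\<close>

inductive RAV :: "nat \<Rightarrow> 'c set \<Rightarrow> (nat \<Rightarrow> 'c set) \<Rightarrow> nat \<Rightarrow> 'c set \<Rightarrow> bool"
  for n :: nat and C :: "'c set" and A :: "nat \<Rightarrow> 'c set" where
  start: "RAV n C A 0 {}"
| round: "RAV n C A j W \<Longrightarrow> c \<in> C - W \<Longrightarrow>
     (\<forall>d\<in>C - W. approval_weight n A W d \<le> approval_weight n A W c) \<Longrightarrow>
     RAV n C A (Suc j) (insert c W)"

lemma RAV_committee:
  assumes "RAV n C A j W"
  shows "W \<subseteq> C \<and> finite W \<and> card W = j"
  using assms by induction auto

lemma RAV_exists:
  assumes "finite C" "j \<le> card C"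
  shows "\<exists>W. RAV n C A j W"
  using assms(2)
proof (induction j)
  case 0
  show ?case by (blast intro: RAV.start)
next
  case (Suc j)
  then obtain W where W: "RAV n C A j W" by auto
  let ?w = "approval_weight n A W"
  have "C - W \<noteq> {}"
    using RAV_committee[OF W] Suc.prems by auto
  then have "Max (?w ` (C - W)) \<in> ?w ` (C - W)"
    using assms(1) by (intro Max_in) auto
  then obtain c where c: "c \<in> C - W" "Max (?w ` (C - W)) = ?w c" by auto
  have "\<forall>d\<in>C - W. ?w d \<le> ?w c"
    using assms(1) c(2) by (metis Max_ge finite_Diff finite_imageI imageI)
  with W c(1) show ?case by (blast intro: RAV.round)
qed

end

theory Submission
  imports Defs
begin

text \<open>
  For \<open>k = 2\<close>: an unrepresented group has at least half of the voters, so the first winner is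
  approved by exactly the remaining half. The supporters of the second winner then all have weight
  \<open>1/2\<close>, and the common candidate of the group would have been a better choice.

  For \<open>k \<ge> 10\<close>: combine star-shaped gadgets, each consisting of a hub and \<open>m\<close> leaves with
  \<open>a\<close> ballots \<open>{hub, leaf}\<close> and \<open>b\<close> ballots \<open>{leaf}\<close> per leaf.
  If \<open>m a > a + b\<close>, RAV picks the hub before its leaves, and if \<open>b + a/2 > 120\<close>, it still picks
  all the leaves before a candidate with \<open>120\<close> supporters. The \<open>m + 1\<close> winners use only
  \<open>m (a + b)\<close> voters. Two gadgets with \<open>(m, a, b) = (2, 81, 80)\<close> and one with
  \<open>(3, 49, 96)\<close> save \<open>38 + 38 + 45 = 121\<close> voters compared to \<open>120\<close> per winner, which pays
  for a further group of \<open>120\<close> voters that remains unrepresented. For \<open>k > 10\<close>, add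
  \<open>k - 10\<close> more such groups: however RAV breaks the ties between them, it leaves one out, and
  there are \<open>120 k - 1\<close> voters in total.
\<close>

text \<open>Voters not yet represented by \<open>W\<close> each still contribute their full weight
  \<open>1\<close>.\<close>

lemma approval_weight_ge_card_group:
  assumes "N' \<subseteq> {1..n}" "\<forall>i\<in>N'. c \<in> A i" "\<forall>i\<in>N'. A i \<inter> W = {}"
  shows "real (card N') \<le> approval_weight n A W c"
proof -
  have "real (card N') = (\<Sum>i\<in>N'. 1 / (1 + real (card (W \<inter> A i))))"
    using assms(3) by (simp add: Int_commute)
  also have "\<dots> \<le> approval_weight n A W c"
    unfolding approval_weight_def using assms(1,2) by (intro sum_mono2) auto
  finally show ?thesis .
qed

lemma RAV_two_provides_JR:
  assumes "1 \<le> n" and A: "\<forall>i\<in>{1..n}. A i \<subseteq> C" and "RAV n C A 2 W"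
  shows "provides_JR n A 2 W"
  unfolding provides_JR_def
proof
  assume "\<exists>N'\<subseteq>{1..n}. real (card N') \<ge> real n / real 2 \<and>
          (\<Inter>i\<in>N'. A i) \<noteq> {} \<and> (\<forall>i\<in>N'. A i \<inter> W = {})"
  then obtain N' c where N': "N' \<subseteq> {1..n}" "real (card N') \<ge> real n / 2"
    and c: "\<forall>i\<in>N'. c \<in> A i" and disj: "\<forall>i\<in>N'. A i \<inter> W = {}" by auto
  from assms(3) have "RAV n C A (Suc (Suc 0)) W" by (simp add: numeral_2_eq_2)
  then obtain W1 c2 where W: "W = insert c2 W1" "RAV n C A (Suc 0) W1"
    and c2: "\<forall>d\<in>C - W1. approval_weight n A W1 d \<le> approval_weight n A W1 c2"
    by (auto elim: RAV.cases)
  from W(2) obtain W0 c1 where W1: "W1 = insert c1 W0" "RAV n C A 0 W0"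
    and c1: "\<forall>d\<in>C - W0. approval_weight n A W0 d \<le> approval_weight n A W0 c1"
    by (auto elim: RAV.cases)
  from W1(2) have W0: "W0 = {}" by (auto elim: RAV.cases)
  note W1 = W1(1)[unfolded W0]
  \<comment> \<open>An empty group would not confine \<open>c\<close> to \<open>C\<close>; a
    nonempty one makes \<open>c\<close> eligible in both rounds, so each winner weighs at least
    \<open>card N'\<close>.\<close>
  have "N' \<noteq> {}" using N'(2) assms(1) by auto
  then have "c \<in> C - W" using N'(1) A c disj by blast
  then have "c \<in> C - W0" "c \<in> C - W1" using W W1 W0 by auto
  then have w1: "real (card N') \<le> approval_weight n A {} c1"
    and w2: "real (card N') \<le> approval_weight n A {c1} c2"
    using approval_weight_ge_card_group[OF N'(1) c, of "{}"] c1
      approval_weight_ge_card_group[OF N'(1) c, of "{c1}"] c2 disj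
    unfolding W W1 W0 by (simp, blast intro: order_trans)+
  define S where "S d = {i. i \<in> {1..n} \<and> d \<in> A i}" for d
  have fin: "finite (S d)" for d unfolding S_def by simp
  have "approval_weight n A {} c1 = card (S c1)"
    by (simp add: approval_weight_def S_def)
  then have large: "card N' \<le> card (S c1)" using w1 by simp
  have sub: "S d \<subseteq> {1..n} - N'" if "d \<in> W" for d
    using that disj unfolding S_def by blast
  have "card ({1..n} - N') = n - card N'"
    using N'(1) by (simp add: card_Diff_subset finite_subset)
  \<comment> \<open>The complement has at most \<open>n / 2\<close> voters, hence at most
    \<open>card N'\<close>.\<close>
  then have "card ({1..n} - N') \<le> card (S c1)" using N'(2) large by linarith
  then have S1: "S c1 = {1..n} - N'"
    using sub[of c1] W W1 by (intro card_seteq) auto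
  have S2: "S c2 \<subseteq> S c1" using sub[of c2] S1 W by auto
  have "approval_weight n A {c1} c2 = (\<Sum>i\<in>S c2. 1 / 2)"
    unfolding approval_weight_def
  proof (rule sum.cong)
    fix i assume "i \<in> S c2"
    then have "{c1} \<inter> A i = {c1}" using S2 unfolding S_def by blast
    then show "1 / (1 + real (card ({c1} \<inter> A i))) = 1 / 2" by simp
  qed (simp add: S_def)
  then have "2 * card N' \<le> card (S c2)" using w2 by simp
  also have "\<dots> \<le> card (S c1)" using S2 fin by (intro card_mono)
  \<comment> \<open>Now \<open>n \<le> 2 * card N' \<le> n - card N'\<close>, although
    \<open>card N' > 0\<close>.\<close>
  finally show False
    using S1 \<open>card ({1..n} - N') = n - card N'\<close> N'(2) assms(1) by simp
qed

text \<open>Voters count from \<open>1\<close>, list positions from \<open>0\<close>.\<close>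

definition profile_of :: "'c set list \<Rightarrow> nat \<Rightarrow> 'c set" where
  "profile_of Bs i = Bs ! (i - 1)"

lemma approval_weight_profile_of:
  "approval_weight (length Bs) (profile_of Bs) W c =
     (\<Sum>B\<leftarrow>Bs. if c \<in> B then 1 / (1 + real (card (W \<inter> B))) else 0)"
proof -
  have "approval_weight (length Bs) (profile_of Bs) W c =
      (\<Sum>i\<in>{1..length Bs}. if c \<in> profile_of Bs i
        then 1 / (1 + real (card (W \<inter> profile_of Bs i))) else 0)"
    unfolding approval_weight_def by (rule sum.inter_filter) simp
  also have "\<dots> = (\<Sum>i<length Bs. if c \<in> Bs ! i then 1 / (1 + real (card (W \<inter> Bs ! i))) else 0)"
    by (intro sum.reindex_bij_witness[of _ Suc "\<lambda>i. i - 1"]) (auto simp: profile_of_def)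
  finally show ?thesis
    by (simp add: sum_list_sum_nth atLeast0LessThan)
qed

text \<open>Hubs are \<open>1\<close>, \<open>4\<close> and \<open>7\<close>.\<close>

definition gadget_ballots :: "nat set list" where
  "gadget_ballots =
     replicate 81 {1, 2} @ replicate 81 {1, 3} @ replicate 80 {2} @ replicate 80 {3} @
     replicate 81 {4, 5} @ replicate 81 {4, 6} @ replicate 80 {5} @ replicate 80 {6} @
     replicate 49 {7, 8} @ replicate 49 {7, 9} @ replicate 49 {7, 10} @
     replicate 96 {8} @ replicate 96 {9} @ replicate 96 {10}"

definition ballots :: "nat \<Rightarrow> nat set list" where
  "ballots k = gadget_ballots @ concat (map (\<lambda>d. replicate 120 {d}) [11..<k + 2])"

text \<open>The gadgets hold \<open>322 + 322 + 435 = 1079\<close> ballots and \<open>k - 9\<close>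
  groups add \<open>120\<close> each. The total stays below \<open>120 * k\<close>, so
  \<open>120\<close> voters are enough for a claim to representation.\<close>

lemma length_ballots:
  assumes "10 \<le> k"
  shows "length (ballots k) = 120 * k - 1"
  using assms
  by (simp add: ballots_def gadget_ballots_def length_concat comp_def sum_list_triv)
    arith

lemma set_ballots_subset:
  assumes "10 \<le> k" "B \<in> set (ballots k)"
  shows "B \<subseteq> {1..k + 1}"
  using assms by (auto simp: ballots_def gadget_ballots_def)

lemma ballot_outside_gadgets:
  "B \<in> set (ballots k) \<Longrightarrow> d \<in> B \<Longrightarrow> 10 < d \<Longrightarrow> B = {d}"
  by (auto simp: ballots_def gadget_ballots_def)

abbreviation weight :: "nat \<Rightarrow> nat set \<Rightarrow> nat \<Rightarrow> real" where
  "weight k \<equiv> approval_weight (length (ballots k)) (profile_of (ballots k))"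

lemma weight_eq:
  "weight k W c =
     (\<Sum>B\<leftarrow>gadget_ballots. if c \<in> B then 1 / (1 + real (card (W \<inter> B))) else 0) +
     (if c \<in> {11..<k + 2} then 120 / (1 + real (card (W \<inter> {c}))) else 0)"
proof -
  let ?f = "\<lambda>B. if c \<in> B then 1 / (1 + real (card (W \<inter> B))) else 0"
  have "sum_list (map ?f (concat (map (\<lambda>d. replicate 120 {d}) ds))) =
      (\<Sum>d\<leftarrow>ds. if c = d then 120 / (1 + real (card (W \<inter> {c}))) else 0)" for ds
    by (induction ds) (auto simp: sum_list_replicate)
  then show ?thesis
    unfolding approval_weight_profile_of ballots_def
    by (simp add: interv_sum_list_conv_sum_set_nat del: upt_Suc)
qed

lemma weight_hub:
  "W \<inter> {1, 2, 3} = {} \<Longrightarrow> weight k W 1 = 162"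
  "W \<inter> {4, 5, 6} = {} \<Longrightarrow> weight k W 4 = 162"
  "W \<inter> {7, 8, 9, 10} = {} \<Longrightarrow> weight k W 7 = 147"
  by (auto simp: weight_eq gadget_ballots_def sum_list_replicate)

text \<open>The worst case is an elected hub: \<open>80 + 81 / 2\<close> and
  \<open>96 + 49 / 2\<close> both equal \<open>120.5\<close>.\<close>

lemma weight_leaf_ge:
  "d \<in> {2, 3, 5, 6, 8, 9, 10} \<Longrightarrow> d \<notin> W \<Longrightarrow> 120 < weight k W d"
  by (elim insertE emptyE;
      simp add: weight_eq gadget_ballots_def sum_list_replicate Int_insert_right)+

text \<open>All supporters at full weight give \<open>81 + 80\<close> and \<open>49 + 96\<close>,
  just short of the hubs' \<open>162\<close> and \<open>147\<close>.\<close>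

lemma weight_leaf_le:
  "d \<in> {2, 3, 5, 6} \<Longrightarrow> d \<notin> W \<Longrightarrow> weight k W d \<le> 161"
  "d \<in> {8, 9, 10} \<Longrightarrow> d \<notin> W \<Longrightarrow> weight k W d \<le> 145"
  by (elim insertE emptyE;
      simp add: weight_eq gadget_ballots_def sum_list_replicate Int_insert_right)+

lemma weight_outside_gadgets:
  "10 < d \<Longrightarrow> weight k W d \<le> 120"
  by (auto simp: weight_eq gadget_ballots_def sum_list_replicate divide_le_eq)

text \<open>The first conjuncts keep the weights of the hubs undiminished until they are elected.\<close>

lemma RAV_ballots_invariant:
  assumes "10 \<le> k" "RAV (length (ballots k)) {1..k + 1} (profile_of (ballots k)) j W"
  shows "(1 \<notin> W \<longrightarrow> 2 \<notin> W \<and> 3 \<notin> W) \<and> (4 \<notin> W \<longrightarrow> 5 \<notin> W \<and> 6 \<notin> W) \<and>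
    (7 \<notin> W \<longrightarrow> 8 \<notin> W \<and> 9 \<notin> W \<and> 10 \<notin> W) \<and> ({1..10} \<subseteq> W \<or> W \<subseteq> {1..10})"
  using assms(2)
proof induction
  case start
  show ?case by simp
next
  case (round j W c)
  let ?w = "weight k W"
  have best: "?w d \<le> ?w c" if "d \<in> {1..10}" "d \<notin> W" for d
    using round.hyps(3) that assms(1) by auto
  have c: "c \<notin> W" "1 \<le> c" using round.hyps(2) by auto
  have 1: "c \<notin> {2, 3}" if "1 \<notin> W"
    using best[of 1] weight_hub(1)[of W k] weight_leaf_le(1)[of c W k] c round.IH that by auto
  have 4: "c \<notin> {5, 6}" if "4 \<notin> W"
    using best[of 4] weight_hub(2)[of W k] weight_leaf_le(1)[of c W k] c round.IH that by auto
  have 7: "c \<notin> {8, 9, 10}" if "7 \<notin> W"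
    using best[of 7] weight_hub(3)[of W k] weight_leaf_le(2)[of c W k] c round.IH that by auto
  have 10: "c \<le> 10" if "\<not> {1..10} \<subseteq> W"
  proof -
    from that obtain d where d: "d \<in> {1..10}" "d \<notin> W" by blast
    then have "d \<in> {1, 4, 7} \<or> d \<in> {2, 3, 5, 6, 8, 9, 10}" by simp presburger
    \<comment> \<open>If a hub is missing, so are its leaves by the induction hypothesis, and the
      hub has its full weight above \<open>120\<close>.\<close>
    then have "120 < ?w d \<or> 1 \<notin> W \<or> 4 \<notin> W \<or> 7 \<notin> W"
      using d weight_leaf_ge[of d W k] by blast
    then have "120 < ?w c"
      using best[OF d] best[of 1] best[of 4] best[of 7] weight_hub[of W k] round.IH by auto
    then show ?thesis using weight_outside_gadgets[of c k W] by linarith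
  qed
  show ?case
  proof (intro conjI)
    show "1 \<notin> insert c W \<longrightarrow> 2 \<notin> insert c W \<and> 3 \<notin> insert c W"
      using 1 round.IH by auto
    show "4 \<notin> insert c W \<longrightarrow> 5 \<notin> insert c W \<and> 6 \<notin> insert c W"
      using 4 round.IH by auto
    show "7 \<notin> insert c W \<longrightarrow> 8 \<notin> insert c W \<and> 9 \<notin> insert c W \<and> 10 \<notin> insert c W"
      using 7 round.IH by auto
    show "{1..10} \<subseteq> insert c W \<or> insert c W \<subseteq> {1..10}"
    proof (cases "{1..10} \<subseteq> W")
      case False
      then have "c \<in> {1..10}" "W \<subseteq> {1..10}" using 10 c(2) round.IH by simp_all
      then show ?thesis by simp
    qed blast
  qed
qed

lemma RAV_ballots_not_JR:
  assumes "10 \<le> k" "RAV (length (ballots k)) {1..k + 1} (profile_of (ballots k)) k W"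
  shows "\<not> provides_JR (length (ballots k)) (profile_of (ballots k)) k W"
proof -
  let ?n = "length (ballots k)" and ?A = "profile_of (ballots k)"
  have W: "W \<subseteq> {1..k + 1}" "finite W" "card W = k" using RAV_committee[OF assms(2)] by auto
  have "{1..10} \<subseteq> W"
  proof (rule ccontr)
    assume "\<not> {1..10} \<subseteq> W"
    then have "W \<subset> {1..10}" using RAV_ballots_invariant[OF assms] by blast
    then have "card W < card {1..10::nat}" by (intro psubset_card_mono) auto
    then show False using W assms(1) by simp
  qed
  \<comment> \<open>There is one candidate more than seats; the one left out lies outside the
    gadgets.\<close>
  moreover obtain d where d: "d \<in> {1..k + 1}" "d \<notin> W"
    using W by (metis Suc_eq_plus1 card_atLeastAtMost diff_Suc_1 n_not_Suc_n subsetI subset_antisym)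
  ultimately have "11 \<le> d" by (fastforce simp: subset_eq not_less_eq_eq)
  define N' where "N' = {i. i \<in> {1..?n} \<and> d \<in> ?A i}"
  have "real (card N') = weight k {} d"
    by (simp add: approval_weight_def N'_def)
  also have "\<dots> = 120"
    using d \<open>11 \<le> d\<close> by (simp add: weight_eq gadget_ballots_def sum_list_replicate)
  finally have "real (card N') \<ge> real ?n / real k"
    using assms(1) by (simp add: length_ballots divide_simps)
  moreover have "?A i = {d}" if "i \<in> N'" for i
  proof -
    have "?A i \<in> set (ballots k)" "d \<in> ?A i"
      using that unfolding N'_def profile_of_def by (auto intro!: nth_mem)
    then show ?thesis
      using ballot_outside_gadgets \<open>11 \<le> d\<close> by auto
  qed
  moreover have "N' \<subseteq> {1..?n}" by (auto simp: N'_def)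
  ultimately show ?thesis
    using d(2) unfolding provides_JR_def by (auto intro!: exI[of _ N'])
qed

theorem theorem7:
  shows "(\<forall>n (C :: 'c set) A W.
            election n C A 2 \<longrightarrow> RAV n C A 2 W \<longrightarrow> provides_JR n A 2 W) \<and>
         (\<forall>k\<ge>10. \<exists>n (C :: nat set) A.
            election n C A k \<and> (\<forall>W. RAV n C A k W \<longrightarrow> \<not> provides_JR n A k W))"
proof (intro conjI allI impI)
  fix n A W and C :: "'c set"
  assume "election n C A 2" "RAV n C A 2 W"
  then show "provides_JR n A 2 W"
    unfolding election_def by (blast intro: RAV_two_provides_JR)
next
  fix k :: nat
  assume k: "10 \<le> k"
  have "profile_of (ballots k) i \<subseteq> {1..k + 1}" if "i \<in> {1..length (ballots k)}" for i
    using that unfolding profile_of_def by (intro set_ballots_subset[OF k] nth_mem) auto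
  then have "election (length (ballots k)) {1..k + 1} (profile_of (ballots k)) k"
    using k unfolding election_def by (simp add: length_ballots)
  then show "\<exists>n (C :: nat set) A.
      election n C A k \<and> (\<forall>W. RAV n C A k W \<longrightarrow> \<not> provides_JR n A k W)"
    using RAV_ballots_not_JR[OF k] by blast
qed

end
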